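(* Let $(\mathbf{W},\mathbf{w})$ be an overcomplete fusion frame for $\mathcal{H}$ such that $W_i\neq\{0\}$ for every $i\in\{1,\ldots,m\}$. Then there exist component preserving dual fusion frames of $(\mathbf{W},\mathbf{w})$ different from $(S_{\mathbf{W},\mathbf{w}}^{-1}\mathbf{W},\mathbf{v})$ for any family of weights $\mathbf{v}$.
   Context: $\mathcal{H}$ is a finite-dimensional Hilbert space over $\mathbb{F}=\mathbb{R}$ or $\mathbb{C}$, $m\in\mathbb{N}$, and $L(\mathcal{X},\mathcal{Y})$ is the space of linear maps $\mathcal{X}\to\mathcal{Y}$. A Bessel fusion sequence $(\mathbf{W},\mathbf{w})=\{(W_i,w_i)\}_{i=1}^m$ is a family of subspaces $W_i$ of $\mathcal{H}$ with weights $w_i>0$. Put $\mathcal{W}=\bigoplus_{i=1}^m W_i=\{(f_i)_{i=1}^m: f_i\in W_i\}$ (external direct sum) with inner product $\langle (f_i),(g_i)\rangle=\sum_i\langle f_i,g_i\rangle$; similarly $\mathcal{V}=\bigoplus_{i=1}^m V_i$ for $(\mathbf{V},\mathbf{v})$. The synthesis operator is $T_{\mathbf{W},\mathbf{w}}:\mathcal{W}\to\mathcal{H}$, $T_{\mathbf{W},\mathbf{w}}(f_i)_{i}=\sum_i w_if_i$, and its adjoint is $T^*_{\mathbf{W},\mathbf{w}}f=(w_i\pi_{W_i}f)_{i}$, where $\pi_{W_i}$ is the orthogonal projection onto $W_i$. $(\mathbf{W},\mathbf{w})$ is a fusion frame for $\mathcal{H}$ if $\mathrm{span}\bigcup_i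 W_i=\mathcal{H}$; in that case $S_{\mathbf{W},\mathbf{w}}=T_{\mathbf{W},\mathbf{w}}T^*_{\mathbf{W},\mathbf{w}}$, i.e. $S_{\mathbf{W},\mathbf{w}}f=\sum_i w_i^2\pi_{W_i}f$, is the (invertible) fusion frame operator, and $(S_{\mathbf{W},\mathbf{w}}^{-1}\mathbf{W},\mathbf{v})$ denotes $\{(S_{\mathbf{W},\mathbf{w}}^{-1}W_i,v_i)\}_{i=1}^m$. $(\mathbf{W},\mathbf{w})$ is a Riesz fusion basis if $\mathcal{H}$ is the (internal) direct sum of the $W_i$. A fusion frame is overcomplete if it is not a Riesz fusion basis. $M_{j,\mathbf{W}}:\mathcal{W}\to\mathcal{W}$ is the operator that keeps the $j$-th component and replaces all others by $0$; $M_{j,\mathbf{V}}$ is the analogous operator on $\mathcal{V}$. A map $Q\in L(\mathcal{W},\mathcal{V})$ is component preserving if $QM_{j,\mathbf{W}}\mathcal{W}=M_{j,\mathbf{V}}\mathcal{V}$ for each $j$. If $(\mathbf{W},\mathbf{w})$, $(\mathbf{V},\mathbf{v})$ are fusion frames for $\mathcal{H}$, then $(\mathbf{V},\mathbf{v})$ is a component preserving dual fusion frame of $(\mathbf{W},\mathbf{w})$ if there is a component preserving $Q\in L(\mathcal{W},\mathcal{V})$ with $T_{\mathbf{V},\mathbf{v}}QT^*_{\mathbf{W},\mathbf{w}}=I_{\mathcal{H}}$. *)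

theory Defs
  imports Complex_Main
begin

text \<open>
  The scalar field is \<open>\<real>\<close> or \<open>\<complex>\<close>. The class has exactly these two models up to isomorphism:
  \<open>norm (x + 1)\<close> squared is real, so \<open>x + cj x\<close> and \<open>x * cj x\<close> are both real, every \<open>x\<close> is a root
  of a real quadratic polynomial, and the field is algebraic over \<open>\<real>\<close>.
\<close>

class real_or_complex = real_normed_field +
  fixes cj :: "'a \<Rightarrow> 'a"
  assumes cj_add: "cj (x + y) = cj x + cj y"
    and cj_mult: "cj (x * y) = cj x * cj y"
    and mult_cj_scaleR: "x * cj x = scaleR ((norm x)\<^sup>2) 1"

lemma mult_cj: "x * cj x = (of_real ((norm x)\<^sup>2) :: 'a::real_or_complex)"
  by (simp only: mult_cj_scaleR of_real_def)

instantiation real :: real_or_complex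
begin
definition cj_real_def: "cj (x :: real) = x"
instance
  by standard (simp_all only: cj_real_def real_norm_def power2_abs real_scaleR_def mult_1_right power2_eq_square)
end

instantiation complex :: real_or_complex
begin
definition cj_complex_def: "cj (x :: complex) = cnj x"
instance
proof
  fix x y :: complex
  show "x * cj x = scaleR ((norm x)\<^sup>2) 1"
    by (simp only: cj_complex_def complex_norm_square[symmetric] scaleR_conv_of_real mult_1_right)
qed (simp_all add: cj_complex_def)
end

locale fd_hilbert_space = vector_space scale
  for scale :: "'k::real_or_complex \<Rightarrow> 'a::ab_group_add \<Rightarrow> 'a" (infixr \<open>*s\<close> 75) +
  fixes ip :: "'a \<Rightarrow> 'a \<Rightarrow> 'k"
  assumes fin_dim: "\<exists>B. finite B \<and> span B = UNIV"
    and ip_add_left: "ip (x + y) z = ip x z + ip y z"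
    and ip_scale_left: "ip (c *s x) y = c * ip x y"
    and ip_commute: "ip y x = cj (ip x y)"
    and ip_pos: "x \<noteq> 0 \<Longrightarrow> \<exists>r>0. ip x x = of_real r"
begin

definition bessel_fusion_seq :: "nat \<Rightarrow> (nat \<Rightarrow> 'a set) \<Rightarrow> (nat \<Rightarrow> real) \<Rightarrow> bool" where
  "bessel_fusion_seq m W w \<longleftrightarrow> (\<forall>i\<in>{1..m}. subspace (W i) \<and> w i > 0)"

definition fusion_frame :: "nat \<Rightarrow> (nat \<Rightarrow> 'a set) \<Rightarrow> (nat \<Rightarrow> real) \<Rightarrow> bool" where
  "fusion_frame m W w \<longleftrightarrow> bessel_fusion_seq m W w \<and> span (\<Union>i\<in>{1..m}. W i) = UNIV"

text \<open>Families are extended by \<open>0\<close> outside the index set, so that equality of families is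
  equality of functions.\<close>

definition dsum :: "nat \<Rightarrow> (nat \<Rightarrow> 'a set) \<Rightarrow> (nat \<Rightarrow> 'a) set" where
  "dsum m W = {f. (\<forall>i\<in>{1..m}. f i \<in> W i) \<and> (\<forall>i. i \<notin> {1..m} \<longrightarrow> f i = 0)}"

definition ip_dsum :: "nat \<Rightarrow> (nat \<Rightarrow> 'a) \<Rightarrow> (nat \<Rightarrow> 'a) \<Rightarrow> 'k" where
  "ip_dsum m f g = (\<Sum>i\<in>{1..m}. ip (f i) (g i))"

definition synthesis :: "nat \<Rightarrow> (nat \<Rightarrow> real) \<Rightarrow> (nat \<Rightarrow> 'a) \<Rightarrow> 'a" where
  "synthesis m w f = (\<Sum>i\<in>{1..m}. of_real (w i) *s f i)"

text \<open>The adjoint of the synthesis operator on \<open>dsum m W\<close>; see \<open>analysis_eq\<close> for the explicit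
  formula.\<close>

definition analysis :: "nat \<Rightarrow> (nat \<Rightarrow> 'a set) \<Rightarrow> (nat \<Rightarrow> real) \<Rightarrow> 'a \<Rightarrow> (nat \<Rightarrow> 'a)" where
  "analysis m W w x =
    (THE g. g \<in> dsum m W \<and> (\<forall>f\<in>dsum m W. ip (synthesis m w f) x = ip_dsum m f g))"

definition frame_op :: "nat \<Rightarrow> (nat \<Rightarrow> 'a set) \<Rightarrow> (nat \<Rightarrow> real) \<Rightarrow> 'a \<Rightarrow> 'a" where
  "frame_op m W w = synthesis m w \<circ> analysis m W w"

text \<open>\<open>inv (frame_op m W w)\<close> is a genuine inverse for fusion frames: see \<open>bij_frame_op\<close>.\<close>

definition riesz_fusion_basis :: "nat \<Rightarrow> (nat \<Rightarrow> 'a set) \<Rightarrow> (nat \<Rightarrow> real) \<Rightarrow> bool" where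
  "riesz_fusion_basis m W w \<longleftrightarrow>
    bessel_fusion_seq m W w \<and> (\<forall>x. \<exists>!f. f \<in> dsum m W \<and> x = (\<Sum>i\<in>{1..m}. f i))"

definition overcomplete_fusion_frame :: "nat \<Rightarrow> (nat \<Rightarrow> 'a set) \<Rightarrow> (nat \<Rightarrow> real) \<Rightarrow> bool" where
  "overcomplete_fusion_frame m W w \<longleftrightarrow> fusion_frame m W w \<and> \<not> riesz_fusion_basis m W w"

text \<open>The space of linear maps from \<open>dsum m W\<close> to \<open>dsum m V\<close>. Values outside \<open>dsum m W\<close> are
  irrelevant.\<close>

definition lin_maps ::
  "nat \<Rightarrow> (nat \<Rightarrow> 'a set) \<Rightarrow> (nat \<Rightarrow> 'a set) \<Rightarrow> ((nat \<Rightarrow> 'a) \<Rightarrow> (nat \<Rightarrow> 'a)) set" where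
  "lin_maps m W V = {Q. (\<forall>f\<in>dsum m W. Q f \<in> dsum m V) \<and>
     (\<forall>f\<in>dsum m W. \<forall>g\<in>dsum m W. Q (\<lambda>i. f i + g i) = (\<lambda>i. Q f i + Q g i)) \<and>
     (\<forall>c. \<forall>f\<in>dsum m W. Q (\<lambda>i. c *s f i) = (\<lambda>i. c *s Q f i))}"

definition keep :: "nat \<Rightarrow> (nat \<Rightarrow> 'a) \<Rightarrow> (nat \<Rightarrow> 'a)" where
  "keep j f = (\<lambda>i. if i = j then f i else 0)"

definition component_preserving ::
  "nat \<Rightarrow> (nat \<Rightarrow> 'a set) \<Rightarrow> (nat \<Rightarrow> 'a set) \<Rightarrow> ((nat \<Rightarrow> 'a) \<Rightarrow> (nat \<Rightarrow> 'a)) \<Rightarrow> bool" where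
  "component_preserving m W V Q \<longleftrightarrow>
     Q \<in> lin_maps m W V \<and> (\<forall>j\<in>{1..m}. Q ` keep j ` dsum m W = keep j ` dsum m V)"

definition cp_dual_fusion_frame ::
  "nat \<Rightarrow> (nat \<Rightarrow> 'a set) \<Rightarrow> (nat \<Rightarrow> real) \<Rightarrow> (nat \<Rightarrow> 'a set) \<Rightarrow> (nat \<Rightarrow> real) \<Rightarrow> bool" where
  "cp_dual_fusion_frame m W w V v \<longleftrightarrow>
     fusion_frame m W w \<and> fusion_frame m V v \<and>
     (\<exists>Q. component_preserving m W V Q \<and> (\<forall>x. synthesis m v (Q (analysis m W w x)) = x))"

definition proj :: "'a set \<Rightarrow> 'a \<Rightarrow> 'a" where
  "proj U x = (THE y. y \<in> U \<and> (\<forall>z\<in>U. ip (x - y) z = 0))"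

lemma cj_0 [simp]: "cj 0 = (0::'k)"
  using cj_add[of "0::'k" 0] by simp

lemma cj_of_real [simp]: "cj (of_real r :: 'k) = of_real r"
proof (cases "r = 0")
  case False
  have "(of_real r :: 'k) * cj (of_real r) = of_real r * of_real r"
    by (simp add: mult_cj power2_eq_square)
  with False show ?thesis by simp
qed simp

lemma ip_add_right: "ip x (y + z) = ip x y + ip x z"
  using cj_add[of "ip y x" "ip z x"] by (simp only: ip_commute[symmetric] ip_add_left[symmetric])

lemma ip_scale_right: "ip x (c *s y) = cj c * ip x y"
  using cj_mult[of c "ip y x"] by (simp only: ip_commute[symmetric] ip_scale_left[symmetric])

lemma ip_zero_left [simp]: "ip 0 x = 0"
  using ip_add_left[of 0 0 x] by simp

lemma ip_zero_right [simp]: "ip x 0 = 0"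
  using ip_add_right[of x 0 0] by simp

lemma ip_eq_0_sym: "ip x y = 0 \<Longrightarrow> ip y x = 0"
  using ip_commute[of y x] by simp

lemma ip_diff_left: "ip (x - y) z = ip x z - ip y z"
  using ip_add_left[of "x - y" y z] by simp

lemma ip_diff_right: "ip x (y - z) = ip x y - ip x z"
  using ip_add_right[of x "y - z" z] by simp

lemma ip_self_eq_0 [simp]: "ip x x = 0 \<longleftrightarrow> x = 0"
  using ip_pos[of x] by (cases "x = 0") auto

lemma ip_sum_left: "ip (sum f A) x = (\<Sum>i\<in>A. ip (f i) x)"
  by (induction A rule: infinite_finite_induct) (auto simp: ip_add_left)

lemma proj_span_ex:
  assumes "finite B"
  shows "\<exists>y\<in>span B. \<forall>z\<in>span B. ip (x - y) z = 0"
  using assms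
proof (induction B arbitrary: x)
  case empty
  then show ?case by simp
next
  case (insert b B)
  obtain p where p: "p \<in> span B" "\<forall>z\<in>span B. ip (b - p) z = 0" using insert.IH by blast
  obtain q where q: "q \<in> span B" "\<forall>z\<in>span B. ip (x - q) z = 0" using insert.IH by blast
  define b' where "b' = b - p"
  define c where "c = ip x b' / ip b' b'"
  have sub: "span B \<subseteq> span (insert b B)" by (rule span_mono) auto
  have b'_in: "b' \<in> span (insert b B)"
    unfolding b'_def using p(1) sub by (meson span_diff span_base insertI1 subsetD)
  have y_in: "q + c *s b' \<in> span (insert b B)"
    using q(1) sub b'_in by (auto intro!: span_add span_scale)
  have qb': "ip q b' = 0"
    unfolding b'_def using p(2) q(1) by (blast intro: ip_eq_0_sym)
  have "ip (x - (q + c *s b')) z = 0" if z: "z \<in> span (insert b B)" for z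
  proof -
    obtain k where k: "z - k *s b \<in> span B" using z span_breakdown_eq by blast
    define s where "s = z - k *s b + k *s p"
    have s: "s \<in> span B" unfolding s_def using k p(1) by (intro span_add span_scale)
    have zeq: "z = k *s b' + s" by (simp add: s_def b'_def scale_right_diff_distrib)
    have "ip x b' - c * ip b' b' = 0"
      by (cases "b' = 0") (auto simp: c_def)
    then have 1: "ip (x - (q + c *s b')) b' = 0"
      by (simp add: ip_diff_left ip_add_left ip_scale_left qb')
    have 2: "ip (x - (q + c *s b')) s = ip (x - q) s - c * ip b' s"
      by (simp add: ip_diff_left ip_add_left ip_scale_left)
    also have "\<dots> = 0" using q(2) p(2) s by (simp add: b'_def)
    finally show ?thesis by (simp add: zeq ip_add_right ip_scale_right 1)
  qed
  then show ?case using y_in by blast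
qed

lemma proj_ex1:
  assumes "subspace U"
  shows "\<exists>!y. y \<in> U \<and> (\<forall>z\<in>U. ip (x - y) z = 0)"
proof -
  obtain B where B: "B \<subseteq> U" "independent B" "U \<subseteq> span B"
    using maximal_independent_subset by blast
  obtain T where "finite T" "span T = UNIV" using fin_dim by blast
  then have "finite B" using independent_span_bound[of T B] B(2) by auto
  moreover have "span B = U"
    using B(1,3) assms by (meson span_minimal subset_antisym)
  ultimately have "\<exists>y\<in>U. \<forall>z\<in>U. ip (x - y) z = 0"
    using proj_span_ex[of B x] by simp
  then obtain y where y: "y \<in> U" "\<forall>z\<in>U. ip (x - y) z = 0" by blast
  have "y' = y" if y': "y' \<in> U" "\<forall>z\<in>U. ip (x - y') z = 0" for y'
  proof -
    have "y' - y \<in> U" using subspace_diff[OF assms y'(1) y(1)] .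
    then have "ip (x - y) (y' - y) - ip (x - y') (y' - y) = 0" using y(2) y'(2) by simp
    then have "ip (y' - y) (y' - y) = 0" by (simp add: ip_diff_left)
    then show ?thesis by simp
  qed
  with y show ?thesis by blast
qed

lemma proj_in: "subspace U \<Longrightarrow> proj U x \<in> U"
  and proj_orth: "subspace U \<Longrightarrow> z \<in> U \<Longrightarrow> ip (x - proj U x) z = 0"
  unfolding proj_def using theI'[OF proj_ex1[of U x]] by blast+

lemma analysis_eq:
  assumes "bessel_fusion_seq m W w"
  shows "analysis m W w x = (\<lambda>i. if i \<in> {1..m} then of_real (w i) *s proj (W i) x else 0)"
    (is "_ = ?g")
  unfolding analysis_def
proof (rule the_equality)
  have W: "subspace (W i)" if "i \<in> {1..m}" for i
    using assms that by (auto simp: bessel_fusion_seq_def)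
  have g: "?g \<in> dsum m W"
    using W by (auto simp: dsum_def intro!: subspace_scale proj_in)
  have adj: "ip (synthesis m w f) x = ip_dsum m f ?g" if f: "f \<in> dsum m W" for f
  proof -
    have "ip (f i) x = ip (f i) (proj (W i) x)" if i: "i \<in> {1..m}" for i
    proof -
      have "f i \<in> W i" using f i by (simp add: dsum_def)
      then have "ip (f i) (x - proj (W i) x) = 0"
        using proj_orth[OF W[OF i]] by (blast intro: ip_eq_0_sym)
      then show ?thesis by (simp add: ip_diff_right)
    qed
    then show ?thesis
      by (simp add: synthesis_def ip_dsum_def ip_sum_left ip_scale_left ip_scale_right)
  qed
  with g show "?g \<in> dsum m W \<and> (\<forall>f\<in>dsum m W. ip (synthesis m w f) x = ip_dsum m f ?g)"
    by blast
  fix h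
  assume h: "h \<in> dsum m W \<and> (\<forall>f\<in>dsum m W. ip (synthesis m w f) x = ip_dsum m f h)"
  have "h i = ?g i" for i
  proof (cases "i \<in> {1..m}")
    case True
    define d where "d = h i - ?g i"
    define e where "e = (\<lambda>j. if j = i then d else 0)"
    have "d \<in> W i"
      unfolding d_def using h g True W[OF True] by (intro subspace_diff) (auto simp: dsum_def)
    then have e: "e \<in> dsum m W"
      using True W by (auto simp: dsum_def e_def subspace_0)
    have single: "ip_dsum m e k = ip d (k i)" for k
    proof -
      have "ip_dsum m e k = (\<Sum>j\<in>{1..m}. if j = i then ip d (k i) else 0)"
        unfolding ip_dsum_def e_def by (intro sum.cong) auto
      then show ?thesis using True by simp
    qed
    have "ip_dsum m e h = ip_dsum m e ?g" 
      using trans[OF sym[OF conjunct2[OF h, rule_format, OF e]] adj[OF e]] .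
    then have "ip d d = 0" unfolding single by (simp add: d_def ip_diff_right)
    then show ?thesis by (simp add: d_def)
  next
    case False
    then show ?thesis using h by (auto simp: dsum_def)
  qed
  then show "h = ?g" by blast
qed

lemma frame_op_eq:
  assumes "bessel_fusion_seq m W w"
  shows "frame_op m W w x = (\<Sum>i\<in>{1..m}. of_real ((w i)\<^sup>2) *s proj (W i) x)"
proof -
  have "frame_op m W w x =
      (\<Sum>i\<in>{1..m}. of_real (w i) *s (if i \<in> {1..m} then of_real (w i) *s proj (W i) x else 0))"
    by (simp only: frame_op_def comp_apply analysis_eq[OF assms] synthesis_def)
  also have "\<dots> = (\<Sum>i\<in>{1..m}. of_real ((w i)\<^sup>2) *s proj (W i) x)"
    by (rule sum.cong) (simp_all only: if_True scale_scale power2_eq_square of_real_mult)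
  finally show ?thesis .
qed

lemma proj_eqI: "subspace U \<Longrightarrow> y \<in> U \<Longrightarrow> (\<And>z. z \<in> U \<Longrightarrow> ip (x - y) z = 0) \<Longrightarrow> proj U x = y"
  using proj_ex1[of U x] proj_in[of U x] proj_orth[of U _ x] by blast

lemma proj_add: "subspace U \<Longrightarrow> proj U (x + y) = proj U x + proj U y"
  by (rule proj_eqI)
    (auto simp: subspace_add proj_in add_diff_add ip_add_left proj_orth)

lemma proj_scale: "subspace U \<Longrightarrow> proj U (c *s x) = c *s proj U x"
  by (rule proj_eqI)
    (auto simp: subspace_scale proj_in scale_right_diff_distrib[symmetric] ip_scale_left proj_orth)

lemma frame_op_add:
  assumes "bessel_fusion_seq m W w"
  shows "frame_op m W w (x + y) = frame_op m W w x + frame_op m W w y"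
  unfolding frame_op_eq[OF assms] sum.distrib[symmetric]
  using assms by (intro sum.cong) (auto simp: bessel_fusion_seq_def proj_add scale_right_distrib)

lemma frame_op_scale:
  assumes "bessel_fusion_seq m W w"
  shows "frame_op m W w (c *s x) = c *s frame_op m W w x"
  unfolding frame_op_eq[OF assms] scale_sum_right
  using assms by (intro sum.cong) (auto simp: bessel_fusion_seq_def proj_scale mult.commute)

lemma frame_op_definite:
  assumes "fusion_frame m W w" and 0: "ip (frame_op m W w x) x = 0"
  shows "x = 0"
proof -
  have b: "bessel_fusion_seq m W w" and sp: "span (\<Union>i\<in>{1..m}. W i) = UNIV"
    using assms by (auto simp: fusion_frame_def)
  have W: "subspace (W i)" "w i > 0" if "i \<in> {1..m}" for i
    using b that by (auto simp: bessel_fusion_seq_def)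
  have "\<exists>r\<ge>0. ip y y = of_real r \<and> (r = 0 \<longrightarrow> y = 0)" for y
  proof (cases "y = 0")
    case True
    then show ?thesis by (intro exI[of _ 0]) simp
  next
    case False
    then obtain r where "r > 0" "ip y y = of_real r" using ip_pos by blast
    then show ?thesis by (intro exI[of _ r]) simp
  qed
  then obtain R where R: "\<And>y. R y \<ge> (0::real)" "\<And>y. ip y y = of_real (R y)" "\<And>y. R y = 0 \<Longrightarrow> y = 0"
    by metis
  have "ip (proj (W i) x) x = of_real (R (proj (W i) x))" if i: "i \<in> {1..m}" for i
  proof -
    have "ip (proj (W i) x) (x - proj (W i) x) = 0"
      using proj_orth[OF W(1)[OF i] proj_in[OF W(1)[OF i]]] by (rule ip_eq_0_sym)
    then show ?thesis by (simp add: ip_diff_right R(2))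
  qed
  then have "ip (frame_op m W w x) x = (\<Sum>i\<in>{1..m}. of_real ((w i)\<^sup>2 * R (proj (W i) x)))"
    unfolding frame_op_eq[OF b] ip_sum_left by (intro sum.cong) (simp_all add: ip_scale_left)
  also have "\<dots> = of_real (\<Sum>i\<in>{1..m}. (w i)\<^sup>2 * R (proj (W i) x))"
    by (rule of_real_sum[symmetric])
  finally have "(\<Sum>i\<in>{1..m}. (w i)\<^sup>2 * R (proj (W i) x)) = 0"
    unfolding 0 by (metis of_real_eq_0_iff)
  then have "\<forall>i\<in>{1..m}. (w i)\<^sup>2 * R (proj (W i) x) = 0"
    by (subst (asm) sum_nonneg_eq_0_iff) (auto intro: mult_nonneg_nonneg R(1))
  then have p0: "proj (W i) x = 0" if "i \<in> {1..m}" for i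
    using R(3) W(2)[OF that] that by fastforce
  have "ip x z = 0" if z: "z \<in> (\<Union>i\<in>{1..m}. W i)" for z
  proof -
    obtain i where i: "i \<in> {1..m}" "z \<in> W i" using z by blast
    show ?thesis using proj_orth[OF W(1)[OF i(1)] i(2), of x] p0[OF i(1)] by simp
  qed
  moreover have "subspace {z. ip x z = 0}"
    by (rule subspaceI) (auto simp: ip_add_right ip_scale_right)
  ultimately have "span (\<Union>i\<in>{1..m}. W i) \<subseteq> {z. ip x z = 0}"
    by (intro span_minimal subsetI CollectI)
  with sp have "ip x x = 0" by blast
  then show ?thesis by simp
qed

lemma bij_frame_op:
  assumes "fusion_frame m W w"
  shows "bij (frame_op m W w)"
proof -
  let ?S = "frame_op m W w"
  have b: "bessel_fusion_seq m W w" using assms by (simp add: fusion_frame_def)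
  have "x = y" if "?S x = ?S y" for x y
  proof -
    have "?S (x - y) = 0" using frame_op_add[OF b, of "x - y" y] that by simp
    then have "x - y = 0" using frame_op_definite[OF assms, of "x - y"] by simp
    then show ?thesis by simp
  qed
  then have "inj ?S" by (rule injI)
  moreover have "surj ?S"
  proof -
    have "?S 0 = 0" using frame_op_add[OF b, of 0 0] by simp
    then have U: "subspace (range ?S)"
      by (intro subspaceI)
        (auto simp: frame_op_add[OF b, symmetric] frame_op_scale[OF b, symmetric] image_iff
          intro: exI[of _ 0])
    have "y \<in> range ?S" for y
    proof -
      let ?d = "y - proj (range ?S) y"
      have "ip ?d (?S ?d) = 0" using proj_orth[OF U rangeI] .
      then have "?d = 0" using frame_op_definite[OF assms] ip_eq_0_sym by blast
      then show ?thesis using proj_in[OF U, of y] by simp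
    qed
    then show ?thesis by blast
  qed
  ultimately show ?thesis by (rule bijI)
qed

end

end

theory Submission
  imports Defs
begin

text \<open>
  With \<open>v = 1\<close>, a component preserving dual amounts to linear maps \<open>A\<^sub>i\<close> satisfying
  \<open>\<Sum> w\<^sub>i A\<^sub>i \<pi>\<^sub>i = I\<close>, and then \<open>V\<^sub>i = A\<^sub>i W\<^sub>i\<close>. The canonical choice is \<open>A\<^sub>i = w\<^sub>i S\<^sup>-\<^sup>1\<close>.
  Overcompleteness provides \<open>f\<^sub>i \<in> W\<^sub>i\<close>, not all zero, with \<open>\<Sum> f\<^sub>i = 0\<close>, so for every \<open>h\<close> the
  perturbation \<open>A\<^sub>i x = w\<^sub>i S\<^sup>-\<^sup>1 x + w\<^sub>i\<^sup>-\<^sup>1 \<langle>x, f\<^sub>i\<rangle> h\<close> is admissible as well. If \<open>f\<^sub>k \<noteq> 0\<close>, take for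
  \<open>h\<close> the multiple of \<open>S\<^sup>-\<^sup>1 f\<^sub>k\<close> for which \<open>A\<^sub>k f\<^sub>k = 0\<close>. Then \<open>S A\<^sub>k\<close> is a multiple of the orthogonal
  projection along \<open>f\<^sub>k\<close>, so \<open>f\<^sub>k \<notin> S V\<^sub>k\<close> and \<open>V\<^sub>k \<noteq> S\<^sup>-\<^sup>1 W\<^sub>k\<close>.
\<close>

context fd_hilbert_space
begin

lemma ip_proj:
  assumes "subspace U" "z \<in> U"
  shows "ip (proj U x) z = ip x z"
  using proj_orth[OF assms, of x] by (simp add: ip_diff_left)

lemma ip_sum_right: "ip x (sum f A) = (\<Sum>i\<in>A. ip x (f i))"
  by (induction A rule: infinite_finite_induct) (auto simp: ip_add_right)

lemma linear_inv_frame_op: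
  assumes "fusion_frame m W w"
  shows "Vector_Spaces.linear scale scale (inv (frame_op m W w))"
proof -
  have b: "bessel_fusion_seq m W w" using assms by (simp add: fusion_frame_def)
  have bij: "bij (frame_op m W w)" by (rule bij_frame_op[OF assms])
  then have i: "inv (frame_op m W w) y = x \<longleftrightarrow> y = frame_op m W w x" for x y
    by (metis bij_inv_eq_iff)
  have s: "frame_op m W w (inv (frame_op m W w) y) = y" for y
    by (rule surj_f_inv_f[OF bij_is_surj[OF bij]])
  show ?thesis
    by unfold_locales
      (simp_all add: i s frame_op_add[OF b] frame_op_scale[OF b] scale_right_distrib scale_left_distrib)
qed

text \<open>The operator \<open>Q\<close> that applies \<open>A i\<close> to the i-th component maps
  \<open>dsum m W\<close> onto the direct sum of the images and commutes with \<open>keep j\<close>,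
  hence is component preserving. The identity \<open>id\<close> serves twice: it is the duality
  equation, and it shows that the images span.\<close>

lemma cp_dual_fusion_frame_imageI:
  assumes ff: "fusion_frame m W w"
    and lin: "\<And>i. Vector_Spaces.linear scale scale (A i)"
    and id: "\<And>x. (\<Sum>i\<in>{1..m}. A i (of_real (w i) *s proj (W i) x)) = x"
  shows "cp_dual_fusion_frame m W w (\<lambda>i. A i ` W i) (\<lambda>_. 1)"
proof -
  let ?V = "\<lambda>i. A i ` W i"
  define Q where "Q = (\<lambda>f i. A i (f i))"
  have b: "bessel_fusion_seq m W w" using ff by (simp add: fusion_frame_def)
  have W: "subspace (W i)" if "i \<in> {1..m}" for i
    using b that by (auto simp: bessel_fusion_seq_def)
  interpret A: Vector_Spaces.linear scale scale "A i" for i by (rule lin)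
  have bV: "bessel_fusion_seq m ?V (\<lambda>_. 1)"
    using W by (auto simp: bessel_fusion_seq_def intro: A.subspace_image)
  have "x \<in> span (\<Union>i\<in>{1..m}. ?V i)" for x
  proof -
    have "(\<Sum>i\<in>{1..m}. A i (of_real (w i) *s proj (W i) x)) \<in> span (\<Union>i\<in>{1..m}. ?V i)"
      by (rule span_sum, rule span_base) (use W in \<open>blast intro: subspace_scale proj_in\<close>)
    then show ?thesis by (simp only: id)
  qed
  with bV have ffV: "fusion_frame m ?V (\<lambda>_. 1)" by (auto simp: fusion_frame_def)
  have Q_in: "Q f \<in> dsum m ?V" if "f \<in> dsum m W" for f
    using that by (auto simp: dsum_def Q_def)
  have Q_onto: "\<exists>f\<in>dsum m W. g = Q f" if g: "g \<in> dsum m ?V" for g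
  proof -
    have "\<forall>i\<in>{1..m}. \<exists>y. y \<in> W i \<and> g i = A i y" using g by (auto simp: dsum_def)
    from bchoice[OF this] obtain h where h: "\<forall>i\<in>{1..m}. h i \<in> W i \<and> g i = A i (h i)" ..
    \<comment> \<open>Elements of \<open>dsum m W\<close> must vanish off the index set, where
      \<open>h\<close> is arbitrary.\<close>
    define f where "f i = (if i \<in> {1..m} then h i else 0)" for i
    have "g i = Q f i" for i
      using h g by (cases "i \<in> {1..m}") (auto simp: f_def Q_def dsum_def)
    moreover have "f \<in> dsum m W" using h by (simp add: dsum_def f_def)
    ultimately show ?thesis by blast
  qed
  have Q_image: "Q ` dsum m W = dsum m ?V" using Q_in Q_onto by blast
  have Q_keep: "Q (keep j f) = keep j (Q f)" for j f
    by (auto simp: Q_def keep_def fun_eq_iff)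
  have "Q ` keep j ` dsum m W = keep j ` dsum m ?V" for j
    unfolding Q_image[symmetric] image_image Q_keep ..
  moreover have "Q \<in> lin_maps m W ?V"
    using Q_in by (auto simp: lin_maps_def Q_def A.add A.scale)
  ultimately have "component_preserving m W ?V Q"
    by (simp add: component_preserving_def)
  moreover have "synthesis m (\<lambda>_. 1) (Q (analysis m W w x)) = x" for x
    using id[of x] by (simp add: synthesis_def Q_def analysis_eq[OF b])
  ultimately show ?thesis
    using ff ffV by (auto simp: cp_dual_fusion_frame_def)
qed

text \<open>Every vector decomposes along the \<open>W i\<close>, so only uniqueness can fail; two
  decompositions of the same vector differ by the desired \<open>f\<close>.\<close>

lemma overcomplete_fusion_frame_dependent:
  assumes "overcomplete_fusion_frame m W w"
  obtains f k where "f \<in> dsum m W" "(\<Sum>i\<in>{1..m}. f i) = 0" "k \<in> {1..m}" "f k \<noteq> 0"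
proof -
  have ff: "fusion_frame m W w" and nr: "\<not> riesz_fusion_basis m W w"
    using assms by (auto simp: overcomplete_fusion_frame_def)
  have b: "bessel_fusion_seq m W w" using ff by (simp add: fusion_frame_def)
  have W: "subspace (W i)" if "i \<in> {1..m}" for i
    using b that by (auto simp: bessel_fusion_seq_def)
  have ex: "\<exists>f. f \<in> dsum m W \<and> x = (\<Sum>i\<in>{1..m}. f i)" for x
  proof -
    \<comment> \<open>Writing \<open>x\<close> as \<open>frame_op m W w y\<close> yields a
      decomposition, since the frame operator is a sum of multiples of projections.\<close>
    obtain y where y: "x = frame_op m W w y"
      using bij_is_surj[OF bij_frame_op[OF ff]] by blast
    let ?f = "\<lambda>i. if i \<in> {1..m} then of_real ((w i)\<^sup>2) *s proj (W i) y else 0"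
    have "?f \<in> dsum m W" using W by (auto simp: dsum_def intro!: subspace_scale proj_in)
    moreover have "x = (\<Sum>i\<in>{1..m}. ?f i)" by (simp add: y frame_op_eq[OF b])
    ultimately show ?thesis by blast
  qed
  obtain x where "\<nexists>!f. f \<in> dsum m W \<and> x = (\<Sum>i\<in>{1..m}. f i)"
    using nr b unfolding riesz_fusion_basis_def by blast
  with ex[of x] obtain f g where fg: "f \<in> dsum m W" "g \<in> dsum m W" "f \<noteq> g"
      "(\<Sum>i\<in>{1..m}. f i) = (\<Sum>i\<in>{1..m}. g i)"
    by metis
  then obtain k where "f k \<noteq> g k" by blast
  moreover from this have "k \<in> {1..m}"
    using fg(1,2) unfolding dsum_def mem_Collect_eq by metis
  moreover have "(\<lambda>i. f i - g i) \<in> dsum m W"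
    using fg(1,2) W by (auto simp: dsum_def intro: subspace_diff)
  moreover have "(\<Sum>i\<in>{1..m}. f i - g i) = 0" using fg(4) by (simp add: sum_subtractf)
  ultimately show ?thesis using that[of "\<lambda>i. f i - g i" k] by simp
qed

lemma overcomplete_fusion_frame_noncanonical_dual:
  assumes "overcomplete_fusion_frame m W w"
  obtains V k where "cp_dual_fusion_frame m W w V (\<lambda>_. 1)" "k \<in> {1..m}"
    "V k \<noteq> inv (frame_op m W w) ` W k"
proof -
  have ff: "fusion_frame m W w" using assms by (simp add: overcomplete_fusion_frame_def)
  have b: "bessel_fusion_seq m W w" using ff by (simp add: fusion_frame_def)
  have W: "subspace (W i)" "w i > 0" if "i \<in> {1..m}" for i
    using b that by (auto simp: bessel_fusion_seq_def)
  obtain f k where f: "f \<in> dsum m W" "(\<Sum>i\<in>{1..m}. f i) = 0" and k: "k \<in> {1..m}" "f k \<noteq> 0"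
    using overcomplete_fusion_frame_dependent[OF assms] .
  have fW: "f i \<in> W i" if "i \<in> {1..m}" for i using f(1) that by (simp add: dsum_def)
  define T where "T = inv (frame_op m W w)"
  interpret T: Vector_Spaces.linear scale scale T
    unfolding T_def by (rule linear_inv_frame_op[OF ff])
  have inj_T: "inj T"
    unfolding T_def by (rule bij_is_inj[OF bij_imp_bij_inv[OF bij_frame_op[OF ff]]])
  \<comment> \<open>This value makes the range of \<open>L k\<close> orthogonal to
    \<open>f k\<close>.\<close>
  define a where "a = of_real ((w k)\<^sup>2) / ip (f k) (f k)"
  \<comment> \<open>\<open>L i\<close> is \<open>A i\<close> before the inverse frame operator is
    applied. Dividing by \<open>w i\<close> cancels the weight contributed by the analysis
    operator.\<close>
  define L where "L i x = of_real (w i) *s x - (a / of_real (w i) * ip x (f i)) *s f k" for i x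
  define A where "A i x = T (L i x)" for i x
  have lin: "Vector_Spaces.linear scale scale (A i)" for i
    by unfold_locales
      (simp_all add: A_def L_def ip_add_left ip_scale_left T.add[symmetric] T.scale[symmetric]
        scale_right_distrib scale_left_distrib scale_right_diff_distrib algebra_simps)
  have "(\<Sum>i\<in>{1..m}. A i (of_real (w i) *s proj (W i) x)) = x" for x
  proof -
    have "(\<Sum>i\<in>{1..m}. L i (of_real (w i) *s proj (W i) x))
        = (\<Sum>i\<in>{1..m}. of_real ((w i)\<^sup>2) *s proj (W i) x - (a * ip x (f i)) *s f k)"
    proof (rule sum.cong)
      fix i assume i: "i \<in> {1..m}"
      show "L i (of_real (w i) *s proj (W i) x)
          = of_real ((w i)\<^sup>2) *s proj (W i) x - (a * ip x (f i)) *s f k"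
        \<comment> \<open>As \<open>f i\<close> lies in \<open>W i\<close>, the projection drops out
          of the inner product with \<open>f i\<close>.\<close>
        using W[OF i] by (simp add: L_def ip_scale_left ip_proj fW[OF i] power2_eq_square)
    qed simp
    also have "\<dots> = frame_op m W w x - (a * (\<Sum>i\<in>{1..m}. ip x (f i))) *s f k"
      by (simp add: sum_subtractf frame_op_eq[OF b] scale_sum_left sum_distrib_left)
    also have "\<dots> = frame_op m W w x"
      by (simp only: ip_sum_right[symmetric] f(2) ip_zero_right mult_zero_right scale_zero_left diff_zero)
    finally show ?thesis
      using bij_is_inj[OF bij_frame_op[OF ff]]
      by (simp add: A_def T.sum[symmetric]) (simp add: T_def)
  qed
  with ff lin have "cp_dual_fusion_frame m W w (\<lambda>i. A i ` W i) (\<lambda>_. 1)"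
    by (rule cp_dual_fusion_frame_imageI)
  moreover have "A k ` W k \<noteq> inv (frame_op m W w) ` W k"
  proof
    assume "A k ` W k = inv (frame_op m W w) ` W k"
    then have "T (f k) \<in> A k ` W k" using fW[OF k(1)] by (simp add: T_def)
    then obtain x where "T (f k) = T (L k x)" by (auto simp: A_def)
    then have "f k = L k x" using inj_T by (simp add: inj_eq)
    moreover have "ip (L k x) (f k) = 0"
      using k(2) W(2)[OF k(1)]
      by (simp add: L_def a_def ip_diff_left ip_scale_left power2_eq_square)
    ultimately show False using k(2) by simp
  qed
  ultimately show ?thesis using k(1) by (intro that)
qed

end

theorem proposition3p9:
  fixes scale :: "'k::real_or_complex \<Rightarrow> 'a::ab_group_add \<Rightarrow> 'a"
    and ip :: "'a \<Rightarrow> 'a \<Rightarrow> 'k"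
    and m :: nat and W :: "nat \<Rightarrow> 'a set" and w :: "nat \<Rightarrow> real"
  assumes "fd_hilbert_space scale ip"
    and "fd_hilbert_space.overcomplete_fusion_frame scale m W w"
    and "\<forall>i\<in>{1..m}. W i \<noteq> {0}"
  shows "\<exists>V v. fd_hilbert_space.cp_dual_fusion_frame scale ip m W w V v \<and>
    (\<forall>u :: nat \<Rightarrow> real. (\<forall>i\<in>{1..m}. u i > 0) \<longrightarrow>
       \<not> (\<forall>i\<in>{1..m}. V i = inv (fd_hilbert_space.frame_op scale ip m W w) ` W i \<and> v i = u i))"
proof -
  interpret fd_hilbert_space scale ip by (rule assms(1))
  \<comment> \<open>The subspaces already differ at one index, so no weights \<open>u\<close> can
    restore equality.\<close>
  show ?thesis
    using overcomplete_fusion_frame_noncanonical_dual[OF assms(2)] by metis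
qed

end
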